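(* Suppose $H$ is a Zero-order-hold Exponential Matrix Control Barrier Function (ZE-MCBF) for the multi-agent dynamics $\dot{\vec x}=F(\vec x)+G(\vec x)\vec u_k$, with constant $c_\alpha>0$; that is, for all $\vec x\in D$ there exists $\vec u\in\mathcal U$ with $$\mathcal L_FH(\vec x)+(\mathcal L_GH(\vec x))(\vec u)\succeq -c_\alpha H(\vec x)+\delta(\Delta_t,c_\alpha)I .$$ For $\vec x\in D$ let $$K(\vec x)=\{\vec u\in\mathcal U:\ \mathcal L_FH(\vec x)+(\mathcal L_GH(\vec x))(\vec u)+c_\alpha H(\vec x)\succeq\delta(\Delta_t,c_\alpha)I\}.$$ Then any feedback control law $\vec\kappa(\cdot)$, applied in zero-order-hold fashion ($\vec u(t)=\vec u_k=\vec\kappa(\vec x(t_k))$ for $t\in[t_k,t_{k+1})$), that satisfies $\vec\kappa(\vec x(t_k))\in K(\vec x(t_k))$ for all $k\in\mathbb N$ renders the set $S=\{\vec x\in\mathbb R^n: H(\vec x)\succeq 0\}$ forward invariant for the closed-loop system.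
   Context: System: there are $N$ agents; agent $i$ has state $x^i\in\mathbb R^{n^i}$, input $u^i\in\mathbb R^{m^i}$ and dynamics $\dot x^i=f^i(x^i)+g^i(x^i)u^i$, with $f^i:\mathbb R^{n^i}\to\mathbb R^{n^i}$ and $g^i:\mathbb R^{n^i}\to\mathbb R^{n^i\times m^i}$ locally Lipschitz. Let $n=\sum_i n^i$, $m=\sum_i m^i$, $\vec x=(x^1,\dots,x^N)\in\mathbb R^n$, $\vec u=(u^1,\dots,u^N)\in\mathbb R^m$, $F(\vec x)=(f^1(x^1),\dots,f^N(x^N))$ (stacked) and $G(\vec x)=\mathrm{blkdiag}(g^1(x^1),\dots,g^N(x^N))$. Inputs are zero-order-hold: with sampling times $t_k=t_0+k\Delta_t$, $k\in\mathbb N$, $\Delta_t>0$, the input is constant, $\vec u(t)=\vec u_k$, on each $[t_k,t_{k+1})$, so $\dot{\vec x}=F(\vec x)+G(\vec x)\vec u_k$ there. Write $\vec x_k=\vec x(t_k)$. Each $u^i$ is constrained to a nonempty convex compact set $\mathcal U^i\subset\mathbb R^{m^i}$; $\mathcal U=\mathcal U^1\times\cdots\times\mathcal U^N$ and $b_u=\sup_{\vec u\in\mathcal U}\|\vec u\|$. Norms and order: $\|\cdot\|$ is the Euclidean norm on vectors, the spectral norm on matrices, and the corresponding induced norm on linear maps. $\mathbb S^p$ is the set of real symmetric $p\times p$ matrices; $A\succeq B$ means $A-B$ is positive semidefinite; $I$ is the identity. Safe set: $H:\mathbb R^n\to\mathbb S^p$ is continuously differentiable with locally Lipschitz Jacobian,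 and $S=\{\vec x\in\mathbb R^n:H(\vec x)\succeq0\}$. Lie derivatives are entrywise: $[\mathcal L_FH]_{ij}=\mathcal L_F(H_{ij})$, and, with $G_j$ the $j$th column of $G$, $(\mathcal L_GH(\vec x))(\vec u)=\sum_{j=1}^m\mathcal L_{G_j}H(\vec x)[\vec u]_j\in\mathbb S^p$, so $\mathcal L_GH(\vec x)$ is a linear map $\mathbb R^m\to\mathbb S^p$. Standing assumptions: $D\subseteq\mathbb R^n$ is a domain with $S\subset D$; the maps $H$, $\mathcal L_FH$, $\mathcal L_GH$ are Lipschitz on $D$ with constants $L_H,L_{FH},L_{GH}\ge0$ respectively; and there are finite $b_F,b_G>0$ with $\sup_{\vec x\in D}\|F(\vec x)\|\le b_F$ and $\sup_{\vec x\in D}\|G(\vec x)\|\le b_G$. Define $$\delta(\Delta_t,c_\alpha)=\Delta_t(L_{FH}+L_{GH}b_u+c_\alpha L_H)(b_F+b_Gb_u).$$ Forward invariance: a set $\mathcal C\subset\mathbb R^n$ is forward invariant for the (closed-loop) system if $\vec x(t_0)\in\mathcal C$ implies $\vec x(t)\in\mathcal C$ for all $t\ge t_0$. No continuity of $\vec\kappa$ is required. *)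

theory Defs
  imports "HOL-Analysis.Analysis"
begin

definition psd :: "real^'p^'p \<Rightarrow> bool" where
  "psd A \<longleftrightarrow> transpose A = A \<and> (\<forall>v. 0 \<le> v \<bullet> (A *v v))"

definition loewner_ge :: "real^'p^'p \<Rightarrow> real^'p^'p \<Rightarrow> bool" (infix "\<succeq>" 50) where
  "A \<succeq> B \<longleftrightarrow> psd (A - B)"

text \<open>
  The library norm on the type of matrices is the Frobenius norm. Viewing a matrix as a bounded
  linear map turns the norm into the spectral norm; likewise \<open>lin_op T\<close> carries the norm
  of a linear map \<open>T\<close> into matrices that is induced by the Euclidean norm and the spectral norm.
\<close>

definition mat_op :: "real^'n^'m \<Rightarrow> (real^'n) \<Rightarrow>\<^sub>L (real^'m)" where
  "mat_op A = Blinfun (\<lambda>v. A *v v)"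

definition lin_op :: "(real^'m \<Rightarrow> real^'p^'p) \<Rightarrow> (real^'m) \<Rightarrow>\<^sub>L ((real^'p) \<Rightarrow>\<^sub>L (real^'p))" where
  "lin_op T = Blinfun (\<lambda>u. mat_op (T u))"

text \<open>The library notion has an additional time argument, which is constant here.\<close>

abbreviation locally_lipschitz_on :: "'a::metric_space set \<Rightarrow> ('a \<Rightarrow> 'b::metric_space) \<Rightarrow> bool" where
  "locally_lipschitz_on X f \<equiv> local_lipschitz (UNIV :: real set) X (\<lambda>_. f)"

definition C1_locally_lipschitz_jacobian ::
    "('a::real_normed_vector \<Rightarrow> 'b::real_normed_vector) \<Rightarrow> bool" where
  "C1_locally_lipschitz_jacobian h \<longleftrightarrow>
     (\<exists>h' :: 'a \<Rightarrow> 'a \<Rightarrow>\<^sub>L 'b.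
        (\<forall>x. (h has_derivative blinfun_apply (h' x)) (at x)) \<and>
        continuous_on UNIV h' \<and> locally_lipschitz_on UNIV h')"

text \<open>
  The coordinates of a stacked vector are indexed by a finite type, and \<open>own j\<close> is the agent that
  coordinate \<open>j\<close> belongs to. The space of agent \<open>i\<close>, whose dimension is
  the number of \<open>j\<close> with \<open>own j = i\<close>, is the subspace \<open>block_space own i\<close> of vectors
  vanishing off these coordinates, and \<open>block own i v\<close> is the component of \<open>v\<close> in it.
  Matrices of agent \<open>i\<close> are embedded in the same way.
\<close>

definition block :: "('k \<Rightarrow> 'a) \<Rightarrow> 'a \<Rightarrow> real^'k \<Rightarrow> real^'k" where
  "block own i v = (\<chi> j. if own j = i then v $ j else 0)"

definition block_space :: "('k \<Rightarrow> 'a) \<Rightarrow> 'a \<Rightarrow> (real^'k) set" where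
  "block_space own i = {v. \<forall>j. own j \<noteq> i \<longrightarrow> v $ j = 0}"

definition block_matrices :: "('n \<Rightarrow> 'a) \<Rightarrow> ('m \<Rightarrow> 'a) \<Rightarrow> 'a \<Rightarrow> (real^'m^'n) set" where
  "block_matrices ownx ownu i = {A. \<forall>j k. \<not> (ownx j = i \<and> ownu k = i) \<longrightarrow> A $ j $ k = 0}"

definition stack :: "('n \<Rightarrow> 'a) \<Rightarrow> ('a \<Rightarrow> real^'n \<Rightarrow> real^'n) \<Rightarrow> real^'n \<Rightarrow> real^'n" where
  "stack ownx f x = (\<chi> j. f (ownx j) (block ownx (ownx j) x) $ j)"

definition blkdiag ::
    "('n \<Rightarrow> 'a) \<Rightarrow> ('m \<Rightarrow> 'a) \<Rightarrow> ('a \<Rightarrow> real^'n \<Rightarrow> real^'m^'n) \<Rightarrow> real^'n \<Rightarrow> real^'m^'n" where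
  "blkdiag ownx ownu g x =
     (\<chi> j k. if ownx j = ownu k then g (ownx j) (block ownx (ownx j) x) $ j $ k else 0)"

definition block_product :: "('m \<Rightarrow> 'a) \<Rightarrow> ('a \<Rightarrow> (real^'m) set) \<Rightarrow> (real^'m) set" where
  "block_product ownu U = {u. \<forall>i. block ownu i u \<in> U i}"

definition lie_deriv :: "(real^'n \<Rightarrow> real^'n) \<Rightarrow> (real^'n \<Rightarrow> real) \<Rightarrow> real^'n \<Rightarrow> real" where
  "lie_deriv V h x = frechet_derivative h (at x) (V x)"

definition lie_mat ::
    "(real^'n \<Rightarrow> real^'n) \<Rightarrow> (real^'n \<Rightarrow> real^'p^'p) \<Rightarrow> real^'n \<Rightarrow> real^'p^'p" where
  "lie_mat V H x = (\<chi> i j. lie_deriv V (\<lambda>y. H y $ i $ j) x)"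

definition lie_input ::
    "(real^'n \<Rightarrow> real^'m^'n) \<Rightarrow> (real^'n \<Rightarrow> real^'p^'p) \<Rightarrow> real^'n \<Rightarrow> real^'m \<Rightarrow> real^'p^'p" where
  "lie_input G H x u = (\<Sum>j\<in>UNIV. (u $ j) *\<^sub>R lie_mat (\<lambda>y. column j (G y)) H x)"

definition zoh_margin ::
    "real \<Rightarrow> real \<Rightarrow> real \<Rightarrow> real \<Rightarrow> real \<Rightarrow> real \<Rightarrow> real \<Rightarrow> real \<Rightarrow> real" where
  "zoh_margin L\<^sub>H L\<^sub>F\<^sub>H L\<^sub>G\<^sub>H b\<^sub>F b\<^sub>G b\<^sub>u \<Delta> c =
     \<Delta> * (L\<^sub>F\<^sub>H + L\<^sub>G\<^sub>H * b\<^sub>u + c * L\<^sub>H) * (b\<^sub>F + b\<^sub>G * b\<^sub>u)"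

text \<open>In both definitions below, \<open>\<delta>\<close> stands for a value of \<^const>\<open>zoh_margin\<close>.\<close>

definition ze_mcbf ::
    "(real^'n \<Rightarrow> real^'n) \<Rightarrow> (real^'n \<Rightarrow> real^'m^'n) \<Rightarrow> (real^'m) set \<Rightarrow> (real^'n) set \<Rightarrow>
     real \<Rightarrow> real \<Rightarrow> (real^'n \<Rightarrow> real^'p^'p) \<Rightarrow> bool" where
  "ze_mcbf F G U D c \<delta> H \<longleftrightarrow>
     (\<forall>x\<in>D. \<exists>u\<in>U. lie_mat F H x + lie_input G H x u \<succeq> - (c *\<^sub>R H x) + \<delta> *\<^sub>R mat 1)"

definition safe_inputs ::
    "(real^'n \<Rightarrow> real^'n) \<Rightarrow> (real^'n \<Rightarrow> real^'m^'n) \<Rightarrow> (real^'m) set \<Rightarrow>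
     real \<Rightarrow> real \<Rightarrow> (real^'n \<Rightarrow> real^'p^'p) \<Rightarrow> real^'n \<Rightarrow> (real^'m) set" where
  "safe_inputs F G U c \<delta> H x =
     {u \<in> U. lie_mat F H x + lie_input G H x u + c *\<^sub>R H x \<succeq> \<delta> *\<^sub>R mat 1}"

definition sample_time :: "real \<Rightarrow> real \<Rightarrow> nat \<Rightarrow> real" where
  "sample_time t\<^sub>0 \<Delta> k = t\<^sub>0 + real k * \<Delta>"

text \<open>
  A trajectory is a pair \<open>(T, x)\<close>, where \<open>x\<close> solves the closed-loop equation on \<open>[t\<^sub>0, T)\<close>
  and \<open>T\<close> may be \<open>\<infinity>\<close>. The derivative at a sampling time is one-sided, since
  the input jumps there.
\<close>

definition zoh_trajectories ::
    "(real^'n \<Rightarrow> real^'n) \<Rightarrow> (real^'n \<Rightarrow> real^'m^'n) \<Rightarrow> real \<Rightarrow> real \<Rightarrow> (real^'n \<Rightarrow> real^'m) \<Rightarrow>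
     (ereal \<times> (real \<Rightarrow> real^'n)) set" where
  "zoh_trajectories F G t\<^sub>0 \<Delta> \<kappa> = {(T, x).
     ereal t\<^sub>0 < T \<and>
     continuous_on {t. t\<^sub>0 \<le> t \<and> ereal t < T} x \<and>
     (\<forall>k. \<forall>t \<in> {sample_time t\<^sub>0 \<Delta> k ..< sample_time t\<^sub>0 \<Delta> (Suc k)}. ereal t < T \<longrightarrow>
        (x has_vector_derivative F (x t) + G (x t) *v \<kappa> (x (sample_time t\<^sub>0 \<Delta> k)))
          (at t within {sample_time t\<^sub>0 \<Delta> k ..< sample_time t\<^sub>0 \<Delta> (Suc k)}))}"

definition forward_invariant :: "real \<Rightarrow> (ereal \<times> (real \<Rightarrow> 's)) set \<Rightarrow> 's set \<Rightarrow> bool" where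
  "forward_invariant t\<^sub>0 \<Sigma> C \<longleftrightarrow>
     (\<forall>(T, x) \<in> \<Sigma>. x t\<^sub>0 \<in> C \<longrightarrow> (\<forall>t. t\<^sub>0 \<le> t \<and> ereal t < T \<longrightarrow> x t \<in> C))"

end

theory Submission
  imports Defs
begin

text \<open>
  Fix a sampling interval that starts in \<open>S\<close> and a vector \<open>v\<close>. While the state stays in \<open>D\<close> it moves by
  at most \<open>\<Delta> * (b\<^sub>F + b\<^sub>G * b\<^sub>u)\<close>, so the margin \<open>\<delta>\<close> absorbs the change of the barrier condition, and
  \<open>\<phi> t = v \<bullet> (H (x t) *v v)\<close> satisfies \<open>\<phi>' \<ge> - c * \<phi>\<close>; hence \<open>\<phi>\<close> stays nonnegative. The state cannot
  leave \<open>D\<close>: at a first exit time it would still be in \<open>S \<subseteq> D\<close>, by continuity.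
\<close>

section \<open>Operator norms and quadratic forms\<close>

lemma mat_op_apply [simp]: "blinfun_apply (mat_op A) v = A *v v"
  unfolding mat_op_def
  by (simp add: bounded_linear_Blinfun_apply matrix_vector_mul_bounded_linear)

text \<open>\<open>Blinfun\<close> is meaningful only on bounded linear functions; linearity
  suffices here because linear maps on finite-dimensional spaces are bounded. This gives access to
  the induced norm in the Lipschitz condition on \<open>lie_input\<close>.\<close>

lemma lin_op_apply:
  assumes "linear T"
  shows "blinfun_apply (lin_op T) u = mat_op (T u)"
proof -
  have "linear (\<lambda>u. mat_op (T u))"
    by (rule linearI; rule blinfun_eqI)
      (simp_all add: blinfun.add_left blinfun.scaleR_left linear_add[OF assms] linear_scale[OF assms]
        matrix_vector_mult_add_rdistrib scaleR_matrix_vector_assoc)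
  then show ?thesis
    by (simp add: lin_op_def bounded_linear_Blinfun_apply linear_conv_bounded_linear)
qed

text \<open>Cauchy-Schwarz followed by the operator norm inequality. The factor
  \<open>v \<bullet> v\<close> is the quadratic form of the identity, so a spectral norm bound
  becomes comparable with a multiple of \<open>mat 1\<close>.\<close>

lemma quadratic_form_bound: "\<bar>v \<bullet> (A *v v)\<bar> \<le> norm (mat_op A) * (v \<bullet> v)"
proof -
  have "\<bar>v \<bullet> (A *v v)\<bar> \<le> norm v * norm (blinfun_apply (mat_op A) v)"
    using Cauchy_Schwarz_ineq2[of v "A *v v"] by simp
  also have "\<dots> \<le> norm v * (norm (mat_op A) * norm v)"
    by (intro mult_left_mono norm_blinfun) simp
  finally show ?thesis
    by (simp add: dot_square_norm power2_eq_square mult_ac)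
qed

lemma bounded_linear_quadratic_form: "bounded_linear (\<lambda>A::real^'p^'p. v \<bullet> (A *v v))"
proof -
  have "linear (\<lambda>A::real^'p^'p. v \<bullet> (A *v v))"
    by (rule linearI)
      (simp_all add: matrix_vector_mult_add_rdistrib inner_add_right
        flip: scaleR_matrix_vector_assoc)
  then show ?thesis
    by (simp add: linear_conv_bounded_linear)
qed

lemma loewner_geD: "A \<succeq> B \<Longrightarrow> v \<bullet> (B *v v) \<le> v \<bullet> (A *v v)"
  unfolding loewner_ge_def psd_def
  by (auto simp: matrix_vector_mult_diff_rdistrib inner_diff_right)

lemma psd_symmetric_iff: "transpose A = A \<Longrightarrow> A \<succeq> 0 \<longleftrightarrow> (\<forall>v. 0 \<le> v \<bullet> (A *v v))"
  by (simp add: loewner_ge_def psd_def)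

section \<open>Lie derivatives through the total derivative\<close>

text \<open>Entry projections are bounded linear, so each entry is differentiated by taking that
  entry of \<open>H'\<close>; uniqueness of the derivative identifies it with
  \<open>frechet_derivative\<close>.\<close>

lemma lie_mat_eq:
  assumes "(H has_derivative H') (at x)"
  shows "lie_mat V H x = H' (V x)"
proof -
  have "((\<lambda>y. H y $ i $ j) has_derivative (\<lambda>h. H' h $ i $ j)) (at x)" for i j
    by (intro bounded_linear.has_derivative[OF bounded_linear_vec_nth] assms)
  then have "frechet_derivative (\<lambda>y. H y $ i $ j) (at x) = (\<lambda>h. H' h $ i $ j)" for i j
    by (rule frechet_derivative_at[symmetric])
  then show ?thesis
    by (simp add: lie_mat_def lie_deriv_def vec_eq_iff)
qed

text \<open>\<open>G x *v u\<close> combines the columns of \<open>G x\<close> with the coefficients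
  \<open>u $ j\<close>, and \<open>H'\<close> is linear. With \<open>lie_mat_eq\<close>, the two Lie
  terms add up to the derivative of \<open>H\<close> along the field with input
  \<open>u\<close>.\<close>

lemma lie_input_eq:
  assumes "(H has_derivative H') (at x)"
  shows "lie_input G H x u = H' (G x *v u)"
proof -
  have "linear H'"
    using assms by (rule has_derivative_linear)
  then show ?thesis
    by (simp add: lie_input_def lie_mat_eq[OF assms] matrix_mult_sum linear_sum linear_scale
        scalar_mult_eq_scaleR)
qed

lemma linear_lie_input: "linear (lie_input G H x)"
  by (rule linearI)
    (simp_all add: lie_input_def scaleR_left_distrib sum.distrib scaleR_sum_right)

section \<open>A comparison inequality and boundedness of the inputs\<close>

text \<open>The integrating factor \<open>exp (c * t)\<close> turns the differential inequality into
  monotonicity of \<open>\<phi> t * exp (c * t)\<close>. Derivatives are taken on the open interval,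
  so input jumps at its ends do no harm.\<close>

lemma nonneg_of_deriv_ge_decay:
  fixes \<phi> :: "real \<Rightarrow> real"
  assumes ab: "a \<le> b" and cont: "continuous_on {a..b} \<phi>" and init: "0 \<le> \<phi> a"
    and deriv: "\<And>t. a < t \<Longrightarrow> t < b \<Longrightarrow> (\<phi> has_real_derivative \<phi>' t) (at t)"
    and ge: "\<And>t. a < t \<Longrightarrow> t < b \<Longrightarrow> - c * \<phi> t \<le> \<phi>' t"
  shows "0 \<le> \<phi> b"
proof -
  have "\<phi> a * exp (c * a) \<le> \<phi> b * exp (c * b)"
  proof (rule DERIV_nonneg_imp_increasing_open[OF ab])
    fix t assume t: "a < t" "t < b"
    have "((\<lambda>t. \<phi> t * exp (c * t)) has_real_derivative (\<phi>' t + c * \<phi> t) * exp (c * t)) (at t)"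
      by (rule derivative_eq_intros deriv[OF t] refl | simp add: algebra_simps)+
    moreover have "0 \<le> (\<phi>' t + c * \<phi> t) * exp (c * t)"
      using ge[OF t] by simp
    ultimately show "\<exists>y. ((\<lambda>t. \<phi> t * exp (c * t)) has_real_derivative y) (at t) \<and> 0 \<le> y"
      by blast
  qed (intro continuous_intros cont)
  moreover have "0 \<le> \<phi> a * exp (c * a)"
    using init by simp
  ultimately have "0 \<le> \<phi> b * exp (c * b)"
    by linarith
  then show ?thesis
    by (simp add: zero_le_mult_iff)
qed

text \<open>Each coordinate of \<open>u\<close> is a coordinate of the block that owns it, and the
  sum of the absolute coordinates dominates the norm.\<close>

lemma bounded_block_product:
  assumes "\<And>i. bounded (U i)"
  shows "bounded (block_product own U :: (real^'m::finite) set)"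
proof -
  obtain B where B: "\<And>i v. v \<in> U i \<Longrightarrow> norm v \<le> B i"
    using assms unfolding bounded_iff by metis
  have "norm u \<le> (\<Sum>j\<in>UNIV. B (own j))" if u: "u \<in> block_product own U" for u :: "real^'m"
  proof -
    have "\<bar>u $ j\<bar> \<le> B (own j)" for j
    proof -
      have "u $ j = block own (own j) u $ j"
        by (simp add: block_def)
      also have "\<bar>\<dots>\<bar> \<le> norm (block own (own j) u)"
        by (rule component_le_norm_cart)
      also have "\<dots> \<le> B (own j)"
        using u B by (auto simp: block_product_def)
      finally show ?thesis .
    qed
    then have "(\<Sum>j\<in>UNIV. \<bar>u $ j\<bar>) \<le> (\<Sum>j\<in>UNIV. B (own j))"
      by (rule sum_mono)
    with norm_le_l1_cart[of u] show ?thesis by linarith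
  qed
  then show ?thesis
    unfolding bounded_iff by blast
qed

section \<open>Safety within one sampling interval\<close>

text \<open>Membership in \<open>D\<close> is assumed only before \<open>b\<close>, while the
  conclusion holds at \<open>b\<close> itself: in this form the lemma applies at a possible first
  exit time from \<open>D\<close>.\<close>

lemma zoh_interval_safe:
  fixes H :: "real^'n::finite \<Rightarrow> real^'p::finite^'p" and G :: "real^'n \<Rightarrow> real^'m::finite^'n"
  assumes ab: "a \<le> b" "b - a \<le> \<Delta>" and c: "0 \<le> c"
    and H': "\<And>y. (H has_derivative H' y) (at y)"
    and H_sym: "\<And>y. transpose (H y) = H y"
    and H_lip: "L\<^sub>H-lipschitz_on D (\<lambda>y. mat_op (H y))"
    and LFH_lip: "L\<^sub>F\<^sub>H-lipschitz_on D (\<lambda>y. mat_op (lie_mat F H y))"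
    and LGH_lip: "L\<^sub>G\<^sub>H-lipschitz_on D (\<lambda>y. lin_op (lie_input G H y))"
    and F_le: "\<And>y. y \<in> D \<Longrightarrow> norm (F y) \<le> b\<^sub>F"
    and G_le: "\<And>y. y \<in> D \<Longrightarrow> norm (mat_op (G y)) \<le> b\<^sub>G"
    and cont: "continuous_on {a..b} x"
    and in_D: "\<And>t. a \<le> t \<Longrightarrow> t < b \<Longrightarrow> x t \<in> D"
    and deriv: "\<And>t. a < t \<Longrightarrow> t < b \<Longrightarrow> (x has_vector_derivative F (x t) + G (x t) *v u) (at t)"
    and u_le: "norm u \<le> b\<^sub>u"
    and u_safe: "u \<in> safe_inputs F G U c (zoh_margin L\<^sub>H L\<^sub>F\<^sub>H L\<^sub>G\<^sub>H b\<^sub>F b\<^sub>G b\<^sub>u \<Delta> c) H (x a)"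
    and init: "H (x a) \<succeq> 0"
  shows "H (x b) \<succeq> 0"
  \<comment> \<open>Since \<open>H\<close> is symmetric everywhere, positivity can be checked for
    one fixed \<open>v\<close> at a time; the argument becomes scalar and no eigenvalue has to be
    differentiated.\<close>
  unfolding psd_symmetric_iff[OF H_sym]
proof
  fix v :: "real^'p"
  define \<delta> where "\<delta> = zoh_margin L\<^sub>H L\<^sub>F\<^sub>H L\<^sub>G\<^sub>H b\<^sub>F b\<^sub>G b\<^sub>u \<Delta> c"
  define q where "q A = v \<bullet> (A *v v)" for A :: "real^'p^'p"
  define E where "E y = lie_mat F H y + lie_input G H y u + c *\<^sub>R H y" for y
  interpret q: bounded_linear q
    unfolding q_def by (rule bounded_linear_quadratic_form)
  have L_nonneg: "0 \<le> L\<^sub>H" "0 \<le> L\<^sub>F\<^sub>H" "0 \<le> L\<^sub>G\<^sub>H"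
    using H_lip LFH_lip LGH_lip by (auto dest: lipschitz_on_nonneg)
  have bu_nonneg: "0 \<le> b\<^sub>u"
    using u_le norm_ge_zero order_trans by blast
  have speed: "norm (F y + G y *v u) \<le> b\<^sub>F + b\<^sub>G * b\<^sub>u" if "y \<in> D" for y
  proof -
    have "norm (G y *v u) \<le> norm (mat_op (G y)) * norm u"
      using norm_blinfun[of "mat_op (G y)" u] by simp
    also have "\<dots> \<le> b\<^sub>G * b\<^sub>u"
      using norm_ge_zero[of "mat_op (G y)"] G_le[OF that]
      by (intro mult_mono u_le norm_ge_zero) linarith+
    finally show ?thesis
      using F_le[OF that] norm_triangle_ineq[of "F y" "G y *v u"] by linarith
  qed
  \<comment> \<open>Hence \<open>q (E (x t))\<close> is \<phi>' + c * \<phi> for \<phi> t =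
    \<open>q (H (x t))\<close>, and the decay inequality amounts to
    \<open>0 \<le> q (E (x t))\<close>.\<close>
  have E_eq: "E y = H' y (F y + G y *v u) + c *\<^sub>R H y" for y
    using linear_add[OF has_derivative_linear[OF H'[of y]]]
    by (simp add: E_def lie_mat_eq[OF H'] lie_input_eq[OF H'])
  \<comment> \<open>The Lipschitz constant is the middle factor of \<open>zoh_margin\<close>. The
    input \<open>u\<close> is held fixed, so only the state differs between the two values.\<close>
  have E_lip: "norm (mat_op (E y - E z)) \<le> (L\<^sub>F\<^sub>H + L\<^sub>G\<^sub>H * b\<^sub>u + c * L\<^sub>H) * dist y z"
    if "y \<in> D" "z \<in> D" for y z
  proof -
    have "norm (mat_op (lie_mat F H y) - mat_op (lie_mat F H z)) \<le> L\<^sub>F\<^sub>H * dist y z"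
      using lipschitz_onD[OF LFH_lip that] by (simp add: dist_norm)
    moreover have "norm (mat_op (lie_input G H y u) - mat_op (lie_input G H z u))
        \<le> L\<^sub>G\<^sub>H * b\<^sub>u * dist y z"
    proof -
      have "norm (mat_op (lie_input G H y u) - mat_op (lie_input G H z u)) =
          norm (blinfun_apply (lin_op (lie_input G H y) - lin_op (lie_input G H z)) u)"
        by (simp add: blinfun.diff_left lin_op_apply[OF linear_lie_input])
      also have "\<dots> \<le> norm (lin_op (lie_input G H y) - lin_op (lie_input G H z)) * norm u"
        by (rule norm_blinfun)
      also have "\<dots> \<le> (L\<^sub>G\<^sub>H * dist y z) * b\<^sub>u"
        using lipschitz_onD[OF LGH_lip that] u_le L_nonneg
        by (intro mult_mono) (auto simp: dist_norm)
      finally show ?thesis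
        by (simp add: mult_ac)
    qed
    moreover have "norm (c *\<^sub>R (mat_op (H y) - mat_op (H z))) \<le> c * L\<^sub>H * dist y z"
      using mult_left_mono[OF lipschitz_onD[OF H_lip that] c] c by (simp add: dist_norm mult_ac)
    moreover have "mat_op (E y - E z) =
        (mat_op (lie_mat F H y) - mat_op (lie_mat F H z)) +
        (mat_op (lie_input G H y u) - mat_op (lie_input G H z u)) +
        c *\<^sub>R (mat_op (H y) - mat_op (H z))"
      by (rule blinfun_eqI)
        (simp add: E_def blinfun.diff_left blinfun.add_left blinfun.scaleR_left
          matrix_vector_mult_diff_rdistrib matrix_vector_mult_add_rdistrib algebra_simps
          flip: scaleR_matrix_vector_assoc)
    ultimately show ?thesis
      by (auto simp: distrib_right intro!: norm_triangle_le add_mono)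
  qed
  have decay: "- c * q (H (x t)) \<le> q (H' (x t) (F (x t) + G (x t) *v u))"
    if t: "a < t" "t < b" for t
  proof -
    have D: "x t \<in> D" "x a \<in> D"
      using t in_D by auto
    \<comment> \<open>Mean value inequality: the intermediate time lies strictly between
      \<open>a\<close> and \<open>t\<close>, where the state is in \<open>D\<close> and
      \<open>speed\<close> applies.\<close>
    have "dist (x t) (x a) \<le> \<Delta> * (b\<^sub>F + b\<^sub>G * b\<^sub>u)"
    proof -
      have "continuous_on {a..t} x"
        using cont t by (auto intro: continuous_on_subset)
      then obtain s where s: "s \<in> {a<..<t}"
        and le: "norm (x t - x a) \<le> norm ((t - a) *\<^sub>R (F (x s) + G (x s) *v u))"
        using mvt_general[of a t x "\<lambda>s h. h *\<^sub>R (F (x s) + G (x s) *v u)"] t deriv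
        by (auto simp: has_vector_derivative_def)
      note le
      also have "\<dots> = (t - a) * norm (F (x s) + G (x s) *v u)"
        using t by simp
      also have "\<dots> \<le> \<Delta> * (b\<^sub>F + b\<^sub>G * b\<^sub>u)"
        using speed[OF in_D, of s] s t ab by (intro mult_mono) auto
      finally show ?thesis
        by (simp add: dist_norm)
    qed
    moreover have "0 \<le> L\<^sub>F\<^sub>H + L\<^sub>G\<^sub>H * b\<^sub>u + c * L\<^sub>H"
      using L_nonneg bu_nonneg c by simp
    ultimately have "(L\<^sub>F\<^sub>H + L\<^sub>G\<^sub>H * b\<^sub>u + c * L\<^sub>H) * dist (x t) (x a)
        \<le> (L\<^sub>F\<^sub>H + L\<^sub>G\<^sub>H * b\<^sub>u + c * L\<^sub>H) * (\<Delta> * (b\<^sub>F + b\<^sub>G * b\<^sub>u))"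
      by (rule mult_left_mono)
    also have "\<dots> = \<delta>"
      unfolding \<delta>_def zoh_margin_def by (simp only: mult_ac)
    finally have "(L\<^sub>F\<^sub>H + L\<^sub>G\<^sub>H * b\<^sub>u + c * L\<^sub>H) * dist (x t) (x a) \<le> \<delta>" .
    with E_lip[OF D] have "norm (mat_op (E (x t) - E (x a))) \<le> \<delta>"
      by (rule order_trans)
    \<comment> \<open>The motion since time \<open>a\<close> costs at most
      \<open>\<delta> * (v \<bullet> v)\<close>, exactly the reserve that the choice of
      \<open>u\<close> at \<open>x a\<close> guarantees.\<close>
    then have "\<bar>q (E (x t)) - q (E (x a))\<bar> \<le> \<delta> * (v \<bullet> v)"
      using quadratic_form_bound[of v "E (x t) - E (x a)"]
        mult_right_mono[of "norm (mat_op (E (x t) - E (x a)))" \<delta> "v \<bullet> v"]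
      by (simp add: q_def matrix_vector_mult_diff_rdistrib inner_diff_right)
    moreover have "\<delta> * (v \<bullet> v) \<le> q (E (x a))"
    proof -
      have "E (x a) \<succeq> \<delta> *\<^sub>R mat 1"
        using u_safe by (simp add: safe_inputs_def E_def \<delta>_def)
      from loewner_geD[OF this, of v] show ?thesis
        by (simp add: q_def flip: scaleR_matrix_vector_assoc)
    qed
    ultimately have "0 \<le> q (E (x t))"
      by linarith
    then show ?thesis
      by (simp add: E_eq q.add q.scaleR)
  qed
  have "0 \<le> q (H (x b))"
  proof (rule nonneg_of_deriv_ge_decay[where \<phi> = "\<lambda>t. q (H (x t))", OF ab(1) _ _ _ decay])
    have "continuous_on UNIV H"
      by (intro continuous_at_imp_continuous_on ballI has_derivative_continuous[OF H'])
    then have "continuous_on {a..b} (\<lambda>t. H (x t))"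
      using cont by (rule continuous_on_compose2) simp
    then show "continuous_on {a..b} (\<lambda>t. q (H (x t)))"
      by (rule q.continuous_on)
    show "0 \<le> q (H (x a))"
      using init by (simp add: q_def psd_symmetric_iff[OF H_sym])
  next
    fix t assume t: "a < t" "t < b"
    have "((\<lambda>t. H (x t)) has_derivative (\<lambda>h. H' (x t) (h *\<^sub>R (F (x t) + G (x t) *v u)))) (at t)"
      using deriv[OF t] H' unfolding has_vector_derivative_def by (rule has_derivative_compose)
    then have "((\<lambda>t. q (H (x t))) has_derivative
        (\<lambda>h. q (H' (x t) (h *\<^sub>R (F (x t) + G (x t) *v u))))) (at t)"
      by (rule q.has_derivative)
    moreover have "(\<lambda>h. q (H' (x t) (h *\<^sub>R (F (x t) + G (x t) *v u)))) =
        (*) (q (H' (x t) (F (x t) + G (x t) *v u)))"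
      by (rule ext) (simp add: linear_scale[OF has_derivative_linear[OF H']] q.scaleR)
    ultimately show "((\<lambda>t. q (H (x t))) has_real_derivative q (H' (x t) (F (x t) + G (x t) *v u))) (at t)"
      by (simp only: has_field_derivative_def)
  qed
  then show "0 \<le> v \<bullet> (H (x b) *v v)"
    by (simp add: q_def)
qed

text \<open>The times in \<open>{a..b}\<close> with \<open>x\<close> outside \<open>D\<close> form a
  compact set, because \<open>D\<close> is open and \<open>x\<close> continuous; at its least
  element \<open>step\<close> would put the state into \<open>S\<close> and so into
  \<open>D\<close>. The start is covered as well: at \<open>t = a\<close> the premise of
  \<open>step\<close> is vacuous.\<close>

lemma stays_in_of_closed_open:
  fixes x :: "real \<Rightarrow> 'a::topological_space"
  assumes "open D" and "S \<subseteq> D" and cont: "continuous_on {a..b} x"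
    and step: "\<And>t. a \<le> t \<Longrightarrow> t \<le> b \<Longrightarrow> (\<And>s. a \<le> s \<Longrightarrow> s < t \<Longrightarrow> x s \<in> D) \<Longrightarrow> x t \<in> S"
    and t: "a \<le> t" "t \<le> b"
  shows "x t \<in> S"
proof -
  define X where "X = {a..b} \<inter> x -` (- D)"
  have "X = {}"
  proof (rule ccontr)
    assume "X \<noteq> {}"
    moreover have "compact X"
    proof -
      have "closed X"
        unfolding X_def using cont \<open>open D\<close>
        by (intro continuous_closed_preimage) auto
      then show ?thesis
        unfolding compact_eq_bounded_closed
        by (auto simp: X_def intro: bounded_subset[OF bounded_closed_interval[of a b]])
    qed
    ultimately obtain \<tau> where \<tau>: "\<tau> \<in> X" "\<And>s. s \<in> X \<Longrightarrow> \<tau> \<le> s"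
      using compact_attains_inf by metis
    then have "x \<tau> \<in> S"
      by (intro step) (force simp: X_def)+
    with \<tau>(1) \<open>S \<subseteq> D\<close> show False
      by (auto simp: X_def)
  qed
  then have "x s \<in> D" if "a \<le> s" "s \<le> b" for s
    using that by (auto simp: X_def)
  with t show ?thesis
    by (intro step) auto
qed

section \<open>Chaining the sampling intervals\<close>

theorem theorem1:
  fixes ownx :: "'n::finite \<Rightarrow> 'agent::finite"
    and ownu :: "'m::finite \<Rightarrow> 'agent"
    and f :: "'agent \<Rightarrow> real^'n \<Rightarrow> real^'n"
    and g :: "'agent \<Rightarrow> real^'n \<Rightarrow> real^'m^'n"
    and Ui :: "'agent \<Rightarrow> (real^'m) set"
    and F :: "real^'n \<Rightarrow> real^'n"
    and G :: "real^'n \<Rightarrow> real^'m^'n"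
    and U :: "(real^'m) set"
    and H :: "real^'n \<Rightarrow> real^'p^'p"
    and S D :: "(real^'n) set"
    and \<kappa> :: "real^'n \<Rightarrow> real^'m"
    and t\<^sub>0 \<Delta> c\<^sub>\<alpha> \<delta> L\<^sub>H L\<^sub>F\<^sub>H L\<^sub>G\<^sub>H b\<^sub>F b\<^sub>G b\<^sub>u :: real
  assumes f_maps: "\<And>i. f i ` block_space ownx i \<subseteq> block_space ownx i"
    and f_lipschitz: "\<And>i. locally_lipschitz_on (block_space ownx i) (f i)"
    and g_maps: "\<And>i. g i ` block_space ownx i \<subseteq> block_matrices ownx ownu i"
    and g_lipschitz: "\<And>i. locally_lipschitz_on (block_space ownx i) (g i)"
    and F_eq: "F = stack ownx f"
    and G_eq: "G = blkdiag ownx ownu g"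
    and Ui: "\<And>i. Ui i \<subseteq> block_space ownu i \<and> Ui i \<noteq> {} \<and> convex (Ui i) \<and> compact (Ui i)"
    and U_eq: "U = block_product ownu Ui"
    and bu_eq: "b\<^sub>u = (SUP u\<in>U. norm u)"
    and H_symmetric: "\<And>x. transpose (H x) = H x"
    and H_smooth: "C1_locally_lipschitz_jacobian H"
    and S_eq: "S = {x. H x \<succeq> 0}"
    and D_domain: "open D" "connected D" "D \<noteq> {}"
    and S_subset: "S \<subseteq> D"
    and H_lipschitz: "L\<^sub>H-lipschitz_on D (\<lambda>x. mat_op (H x))"
    and LFH_lipschitz: "L\<^sub>F\<^sub>H-lipschitz_on D (\<lambda>x. mat_op (lie_mat F H x))"
    and LGH_lipschitz: "L\<^sub>G\<^sub>H-lipschitz_on D (\<lambda>x. lin_op (lie_input G H x))"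
    and F_bound: "0 < b\<^sub>F" "\<And>x. x \<in> D \<Longrightarrow> norm (F x) \<le> b\<^sub>F"
    and G_bound: "0 < b\<^sub>G" "\<And>x. x \<in> D \<Longrightarrow> norm (mat_op (G x)) \<le> b\<^sub>G"
    and Delta_pos: "0 < \<Delta>"
    and c_pos: "0 < c\<^sub>\<alpha>"
    and delta_eq: "\<delta> = zoh_margin L\<^sub>H L\<^sub>F\<^sub>H L\<^sub>G\<^sub>H b\<^sub>F b\<^sub>G b\<^sub>u \<Delta> c\<^sub>\<alpha>"
    and H_ze_mcbf: "ze_mcbf F G U D c\<^sub>\<alpha> \<delta> H"
    and \<kappa>_safe: "\<And>T x k. (T, x) \<in> zoh_trajectories F G t\<^sub>0 \<Delta> \<kappa> \<Longrightarrow> x t\<^sub>0 \<in> S \<Longrightarrow>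
        ereal (sample_time t\<^sub>0 \<Delta> k) < T \<Longrightarrow> x (sample_time t\<^sub>0 \<Delta> k) \<in> D \<Longrightarrow>
        \<kappa> (x (sample_time t\<^sub>0 \<Delta> k)) \<in> safe_inputs F G U c\<^sub>\<alpha> \<delta> H (x (sample_time t\<^sub>0 \<Delta> k))"
  shows "forward_invariant t\<^sub>0 (zoh_trajectories F G t\<^sub>0 \<Delta> \<kappa>) S"
proof -
  from H_smooth obtain H' where H': "\<And>y. (H has_derivative blinfun_apply (H' y)) (at y)"
    unfolding C1_locally_lipschitz_jacobian_def by blast
  \<comment> \<open>A real supremum is an upper bound only for a set that is bounded above;
    compactness of the agents' input sets provides this.\<close>
  have norm_le_bu: "norm u \<le> b\<^sub>u" if "u \<in> U" for u
  proof -
    have "bounded U"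
      unfolding U_eq using Ui by (intro bounded_block_product compact_imp_bounded) auto
    then have "bdd_above (norm ` U)"
      by (auto simp: bounded_iff intro: bdd_aboveI2)
    then show ?thesis
      unfolding bu_eq using that by (rule cSUP_upper2) simp
  qed
  have sample_Suc: "sample_time t\<^sub>0 \<Delta> (Suc k) = sample_time t\<^sub>0 \<Delta> k + \<Delta>" for k
    by (simp add: sample_time_def algebra_simps)
  have sample_ge: "t\<^sub>0 \<le> sample_time t\<^sub>0 \<Delta> k" for k
    using Delta_pos by (simp add: sample_time_def)
  have "x t \<in> S" if traj: "(T, x) \<in> zoh_trajectories F G t\<^sub>0 \<Delta> \<kappa>" and x0: "x t\<^sub>0 \<in> S"
    and t: "t\<^sub>0 \<le> t" "ereal t < T" for T x t
  proof -
    have cont: "continuous_on {t. t\<^sub>0 \<le> t \<and> ereal t < T} x"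
      using traj by (simp add: zoh_trajectories_def)
    have before: "ereal r < T" if "r \<le> s" "ereal s < T" for r s
      using that(2) by (rule le_less_trans[rotated]) (simp add: that(1))
    \<comment> \<open>The right endpoint is included, so the result for interval \<open>k\<close>
      also yields the starting condition for the next one.\<close>
    have interval: "x s \<in> S"
      if xk: "x (sample_time t\<^sub>0 \<Delta> k) \<in> S" and s: "sample_time t\<^sub>0 \<Delta> k \<le> s"
        "s \<le> sample_time t\<^sub>0 \<Delta> (Suc k)" "ereal s < T" for k s
    proof -
      let ?a = "sample_time t\<^sub>0 \<Delta> k"
      have before_T: "ereal r < T" if "r \<le> s" for r
        using that s(3) by (rule before)
      have cont_s: "continuous_on {?a..s} x"
        using before_T sample_ge[of k] by (intro continuous_on_subset[OF cont]) auto
      \<comment> \<open>The law is assumed safe only at samples in \<open>D\<close>; this sample is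
        in \<open>S\<close>, hence in \<open>D\<close>, so the argument moves forward in time
        without circularity.\<close>
      have \<kappa>: "\<kappa> (x ?a) \<in> safe_inputs F G U c\<^sub>\<alpha> \<delta> H (x ?a)"
        using \<kappa>_safe[OF traj x0 before_T[OF s(1)]] xk S_subset by blast
      \<comment> \<open>Strictly inside the sampling interval the derivative relative to the
        half-open interval is two-sided.\<close>
      have deriv: "(x has_vector_derivative F (x r) + G (x r) *v \<kappa> (x ?a)) (at r)"
        if r: "?a < r" "r < s" for r
      proof -
        have "(x has_vector_derivative F (x r) + G (x r) *v \<kappa> (x ?a))
            (at r within {?a ..< sample_time t\<^sub>0 \<Delta> (Suc k)})"
          using traj r s(2) before_T[of r] by (auto simp: zoh_trajectories_def)
        moreover have "at r within {?a ..< sample_time t\<^sub>0 \<Delta> (Suc k)} = at r"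
          using r s(2) by (intro at_within_interior) (simp add: interior_atLeastLessThan)
        ultimately show ?thesis
          by simp
      qed
      show ?thesis
      \<comment> \<open>The exit argument runs on \<open>{?a..s}\<close>, and its step is
        \<open>zoh_interval_safe\<close> on \<open>{?a..r}\<close>.\<close>
      proof (rule stays_in_of_closed_open[OF D_domain(1) S_subset cont_s _ s(1) order_refl])
        fix r assume r: "?a \<le> r" "r \<le> s" and in_D: "\<And>q. ?a \<le> q \<Longrightarrow> q < r \<Longrightarrow> x q \<in> D"
        have "H (x r) \<succeq> 0"
        proof (rule zoh_interval_safe[OF r(1) _ _ H' H_symmetric H_lipschitz LFH_lipschitz
              LGH_lipschitz F_bound(2) G_bound(2) _ in_D deriv norm_le_bu])
          show "r - ?a \<le> \<Delta>"
            using r s(2) sample_Suc[of k] by linarith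
          show "continuous_on {?a..r} x"
            using r by (intro continuous_on_subset[OF cont_s]) auto
          show "\<kappa> (x ?a) \<in> U"
            using \<kappa> by (simp add: safe_inputs_def)
          show "\<kappa> (x ?a) \<in> safe_inputs F G U c\<^sub>\<alpha>
              (zoh_margin L\<^sub>H L\<^sub>F\<^sub>H L\<^sub>G\<^sub>H b\<^sub>F b\<^sub>G b\<^sub>u \<Delta> c\<^sub>\<alpha>) H (x ?a)"
            using \<kappa> by (simp add: delta_eq)
          show "H (x ?a) \<succeq> 0"
            using xk by (simp add: S_eq)
        qed (use c_pos r in auto)
        then show "x r \<in> S"
          by (simp add: S_eq)
      qed
    qed
    have sample: "ereal (sample_time t\<^sub>0 \<Delta> k) < T \<Longrightarrow> x (sample_time t\<^sub>0 \<Delta> k) \<in> S" for k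
    proof (induction k)
      case 0
      then show ?case
        using x0 by (simp add: sample_time_def)
    next
      case (Suc k)
      have le: "sample_time t\<^sub>0 \<Delta> k \<le> sample_time t\<^sub>0 \<Delta> (Suc k)"
        using sample_Suc Delta_pos by simp
      show ?case
        using Suc.IH[OF before[OF le Suc.prems]] le order_refl Suc.prems by (rule interval)
    qed
    \<comment> \<open>The index of the sampling interval containing \<open>t\<close>; the quotient
      is nonnegative, so \<open>nat\<close> truncates nothing.\<close>
    define k where "k = nat \<lfloor>(t - t\<^sub>0) / \<Delta>\<rfloor>"
    have "0 \<le> (t - t\<^sub>0) / \<Delta>"
      using t(1) Delta_pos by simp
    then have "real k \<le> (t - t\<^sub>0) / \<Delta>" "(t - t\<^sub>0) / \<Delta> \<le> real k + 1"
      unfolding k_def by linarith+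
    then have k: "sample_time t\<^sub>0 \<Delta> k \<le> t" "t \<le> sample_time t\<^sub>0 \<Delta> (Suc k)"
      using Delta_pos by (auto simp: sample_time_def field_simps)
    show ?thesis
      using sample[OF before[OF k(1) t(2)]] k t(2) by (rule interval)
  qed
  then show ?thesis
    unfolding forward_invariant_def by blast
qed

end
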